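(* Let $R$ be a (not necessarily commutative) ring with $1$ and let $n$ be a positive integer. In the bijective correspondence $I\mapsto\Phi(I)$, $N\mapsto\Psi(N)$ between left ideals $I$ of $M_n(R)$ and (left) submodules $N$ of $R^n$, prime submodules of $R^n$ correspond to prime left ideals of $M_n(R)$, and semiprime submodules of $R^n$ correspond to semiprime left ideals of $M_n(R)$.
   Context: $R^n$ is regarded as a left $R$-module of row vectors, and $M_n(R)$ is the ring of $n\times n$ matrices over $R$. For a left ideal $I$ of $M_n(R)$, $\Phi(I)$ is the set of all $\mathbf{m}\in R^n$ such that the matrix with first row $\mathbf{m}$ and all other rows zero belongs to $I$ (equivalently, the set of all rows of all elements of $I$); it is a submodule of $R^n$. For a submodule $N$ of $R^n$, $\Psi(N)$ is the set of all matrices in $M_n(R)$ all of whose rows belong to $N$; it is a left ideal. The maps $\Phi$ and $\Psi$ are mutually inverse. A submodule $N$ of a left $R$-module $M$ is prime if for every $r\in R$ and $\mathbf{m}\in M$ such that $rR\mathbf{m}\subseteq N$ we have $\mathbf{m}\in N$ or $rM\subseteq N$. A submodule $N$ of the left $R$-module $R^n$ is semiprime if for every $\mathbf{m}=(m_1,\ldots,m_n)\in R^n$ such that $m_iR\mathbf{m}\subseteq N$ for $i=1,\ldots,n$ we have $\mathbf{m}\in N$. A left ideal $I$ of a ring $S$ with $1$ is prime if for all $x,y\in S$, $xSy\subseteq I$ implies that $xS\subseteq I$ or $y\in I$; it is semiprime if for all $x\in S$, $xSx\subseteq I$ implies $x\in I$. None of these notions requires properness. *)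

theory Defs
  imports
    "HOL-Algebra.Ideal"
    "HOL-Algebra.Module"
    "Jordan_Normal_Form.Matrix"
begin

text \<open>
  Rings are HOL-Algebra records with explicit carriers, so the coefficient ring need not be
  commutative and may be the zero ring. Vectors and matrices are of the types \<^typ>\<open>'a vec\<close> and
  \<^typ>\<open>'a mat\<close>, but the arithmetic on them is taken from the record: the operations of
  Jordan_Normal_Form use the type class operations on the entries.
\<close>

definition mat_ring :: "('a, 'b) ring_scheme \<Rightarrow> nat \<Rightarrow> 'a mat ring" where
  "mat_ring R n = \<lparr>
     carrier = {A \<in> carrier_mat n n. elements_mat A \<subseteq> carrier R},
     monoid.mult = (\<lambda>A B. mat n n (\<lambda>(i, j). \<Oplus>\<^bsub>R\<^esub>k\<in>{..<n}. A $$ (i, k) \<otimes>\<^bsub>R\<^esub> B $$ (k, j))),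
     one = mat n n (\<lambda>(i, j). if i = j then \<one>\<^bsub>R\<^esub> else \<zero>\<^bsub>R\<^esub>),
     zero = mat n n (\<lambda>_. \<zero>\<^bsub>R\<^esub>),
     add = (\<lambda>A B. mat n n (\<lambda>(i, j). A $$ (i, j) \<oplus>\<^bsub>R\<^esub> B $$ (i, j)))\<rparr>"

text \<open>The fields \<^const>\<open>monoid.mult\<close> and \<^const>\<open>one\<close> of a module record play no role.\<close>

definition row_module :: "('a, 'b) ring_scheme \<Rightarrow> nat \<Rightarrow> ('a, 'a vec) module" where
  "row_module R n = \<lparr>
     carrier = {v \<in> carrier_vec n. vec_set v \<subseteq> carrier R},
     monoid.mult = undefined,
     one = undefined,
     zero = vec n (\<lambda>_. \<zero>\<^bsub>R\<^esub>),
     add = (\<lambda>v w. vec n (\<lambda>i. v $ i \<oplus>\<^bsub>R\<^esub> w $ i)),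
     smult = (\<lambda>r v. vec n (\<lambda>i. r \<otimes>\<^bsub>R\<^esub> v $ i))\<rparr>"

text \<open>
  The locale \<^locale>\<open>Module.module\<close> requires a commutative ring, but \<^locale>\<open>submodule\<close> only asks for an
  additive subgroup closed under the scalar action, so it also describes left submodules over
  noncommutative rings.
\<close>

definition prime_submodule ::
    "'m set \<Rightarrow> ('a, 'b) ring_scheme \<Rightarrow> ('a, 'm, 'c) module_scheme \<Rightarrow> bool" where
  "prime_submodule N R M \<longleftrightarrow> submodule N R M \<and>
     (\<forall>r \<in> carrier R. \<forall>m \<in> carrier M.
        (\<forall>s \<in> carrier R. (r \<otimes>\<^bsub>R\<^esub> s) \<odot>\<^bsub>M\<^esub> m \<in> N) \<longrightarrow>
        m \<in> N \<or> (\<forall>x \<in> carrier M. r \<odot>\<^bsub>M\<^esub> x \<in> N))"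

definition semiprime_submodule ::
    "'a vec set \<Rightarrow> ('a, 'b) ring_scheme \<Rightarrow> nat \<Rightarrow> bool" where
  "semiprime_submodule N R n \<longleftrightarrow> submodule N R (row_module R n) \<and>
     (\<forall>m \<in> carrier (row_module R n).
        (\<forall>i<n. \<forall>s \<in> carrier R. (m $ i \<otimes>\<^bsub>R\<^esub> s) \<odot>\<^bsub>row_module R n\<^esub> m \<in> N) \<longrightarrow> m \<in> N)"

definition left_ideal :: "'a set \<Rightarrow> ('a, 'b) ring_scheme \<Rightarrow> bool" where
  "left_ideal I S \<longleftrightarrow> additive_subgroup I S \<and>
     (\<forall>s \<in> carrier S. \<forall>x \<in> I. s \<otimes>\<^bsub>S\<^esub> x \<in> I)"

definition prime_left_ideal :: "'a set \<Rightarrow> ('a, 'b) ring_scheme \<Rightarrow> bool" where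
  "prime_left_ideal I S \<longleftrightarrow> left_ideal I S \<and>
     (\<forall>x \<in> carrier S. \<forall>y \<in> carrier S.
        (\<forall>s \<in> carrier S. x \<otimes>\<^bsub>S\<^esub> s \<otimes>\<^bsub>S\<^esub> y \<in> I) \<longrightarrow>
        (\<forall>s \<in> carrier S. x \<otimes>\<^bsub>S\<^esub> s \<in> I) \<or> y \<in> I)"

definition semiprime_left_ideal :: "'a set \<Rightarrow> ('a, 'b) ring_scheme \<Rightarrow> bool" where
  "semiprime_left_ideal I S \<longleftrightarrow> left_ideal I S \<and>
     (\<forall>x \<in> carrier S. (\<forall>s \<in> carrier S. x \<otimes>\<^bsub>S\<^esub> s \<otimes>\<^bsub>S\<^esub> x \<in> I) \<longrightarrow> x \<in> I)"

text \<open>Rows are indexed from 0, so the first row is the one with index 0.\<close>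

definition Phi :: "('a, 'b) ring_scheme \<Rightarrow> nat \<Rightarrow> 'a mat set \<Rightarrow> 'a vec set" where
  "Phi R n I = {m \<in> carrier (row_module R n).
     mat n n (\<lambda>(i, j). if i = 0 then m $ j else \<zero>\<^bsub>R\<^esub>) \<in> I}"

definition Psi :: "('a, 'b) ring_scheme \<Rightarrow> nat \<Rightarrow> 'a vec set \<Rightarrow> 'a mat set" where
  "Psi R n N = {A \<in> carrier (mat_ring R n). \<forall>i<n. row A i \<in> N}"

end

theory Submission
  imports Defs
begin

text \<open>
  Row \<open>i\<close> of a product \<open>A B\<close> is the linear combination of the rows of \<open>B\<close> whose coefficients are the
  entries in row \<open>i\<close> of \<open>A\<close>. This one formula carries the whole correspondence.

  A left ideal \<open>I\<close> is determined by the rows of its elements: left multiplication by matrix units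
  extracts a row, moves it to any other row position and kills the remaining rows
  (\<open>unit_mult\<close>), and a matrix is the sum of its rows put in place (\<open>sum_of_rows\<close>). Hence
  \<open>A \<in> I\<close> as soon as every row of \<open>A\<close> is the first row of some matrix in \<open>I\<close> that vanishes elsewhere;
  this is \<open>Psi_Phi\<close>. The other composite, \<open>Phi_Psi\<close>, is immediate.

  For primeness, products \<open>x s y\<close> with \<open>s\<close> a multiple of a matrix unit have as rows the vectors
  \<open>(x\<^sub>i\<^sub>j r) y\<^sub>k\<close>, where \<open>y\<^sub>k\<close> is row \<open>k\<close> of \<open>y\<close>, and a general product has rows that are sums of
  such vectors. So, with \<open>S\<close> the matrix ring, \<open>x S y \<subseteq> \<Psi>(N)\<close> means \<open>x\<^sub>i\<^sub>j R y\<^sub>k \<subseteq> N\<close> for all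
  \<open>i\<close>, \<open>j\<close>, \<open>k\<close> (\<open>sandwich_in_Psi_iff\<close>), and likewise \<open>x S \<subseteq> \<Psi>(N)\<close> means \<open>x\<^sub>i\<^sub>j R\<^sup>n \<subseteq> N\<close> for all
  \<open>i\<close>, \<open>j\<close> (\<open>right_multiples_in_Psi_iff\<close>). Both conditions on ideals thereby become the conditions on
  submodules, applied to one pair of an entry and a row at a time; for the converse directions a
  scalar or a vector is placed in an otherwise zero matrix. Since every left ideal has the form
  \<open>\<Psi>(N)\<close>, this suffices.
\<close>

section \<open>The additive groups of rows and matrices\<close>

lemma (in abelian_group) subgroup_finsum_closed:
  assumes H: "subgroup H (add_monoid G)" and "finite K" "\<And>k. k \<in> K \<Longrightarrow> f k \<in> H"
  shows "(\<Oplus>k\<in>K. f k) \<in> H"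
  using assms(2,3)
proof (induction K rule: finite_induct)
  case empty
  show ?case using subgroup.one_closed[OF H] by simp
next
  case (insert k K)
  have sub: "H \<subseteq> carrier G" using subgroup.subset[OF H] by simp
  have "(\<Oplus>i\<in>insert k K. f i) = f k \<oplus> (\<Oplus>i\<in>K. f i)"
    using insert sub by (intro finsum_insert) auto
  then show ?case using subgroup.m_closed[OF H] insert by simp
qed

locale matrix_setting = ring R for R (structure) +
  fixes n :: nat
begin

abbreviation "S \<equiv> mat_ring R n"
abbreviation "V \<equiv> row_module R n"

lemma mats_carrier_iff:
  "A \<in> carrier S \<longleftrightarrow> A \<in> carrier_mat n n \<and> (\<forall>i<n. \<forall>j<n. A $$ (i, j) \<in> carrier R)"
  unfolding mat_ring_def by (auto dest!: elements_matD)

lemma rows_carrier_iff: "v \<in> carrier V \<longleftrightarrow> dim_vec v = n \<and> (\<forall>j<n. v $ j \<in> carrier R)"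
  unfolding row_module_def by (auto simp: vec_set_def)

lemma row_module_simps:
  "\<zero>\<^bsub>V\<^esub> = vec n (\<lambda>_. \<zero>)"
  "v \<oplus>\<^bsub>V\<^esub> w = vec n (\<lambda>i. v $ i \<oplus> w $ i)"
  "r \<odot>\<^bsub>V\<^esub> v = vec n (\<lambda>i. r \<otimes> v $ i)"
  unfolding row_module_def by simp_all

lemma mat_ring_simps:
  "\<zero>\<^bsub>S\<^esub> = mat n n (\<lambda>_. \<zero>)"
  "A \<oplus>\<^bsub>S\<^esub> B = mat n n (\<lambda>(i, j). A $$ (i, j) \<oplus> B $$ (i, j))"
  "A \<otimes>\<^bsub>S\<^esub> B = mat n n (\<lambda>(i, j). \<Oplus>k\<in>{..<n}. A $$ (i, k) \<otimes> B $$ (k, j))"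
  unfolding mat_ring_def by simp_all

lemma rows_abelian_group: "abelian_group V"
proof (rule abelian_groupI)
  fix v assume "v \<in> carrier V"
  then show "\<exists>w \<in> carrier V. w \<oplus>\<^bsub>V\<^esub> v = \<zero>\<^bsub>V\<^esub>"
    by (intro bexI[of _ "vec n (\<lambda>i. \<ominus> v $ i)"]) (auto simp: rows_carrier_iff row_module_simps l_neg)
qed (auto simp: rows_carrier_iff row_module_simps a_ac)

lemma mats_abelian_group: "abelian_group S"
proof (rule abelian_groupI)
  fix A assume "A \<in> carrier S"
  then show "\<exists>B \<in> carrier S. B \<oplus>\<^bsub>S\<^esub> A = \<zero>\<^bsub>S\<^esub>"
    by (intro bexI[of _ "mat n n (\<lambda>(i, j). \<ominus> A $$ (i, j))"])
      (auto simp: mats_carrier_iff mat_ring_simps l_neg)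
qed (auto simp: mats_carrier_iff mat_ring_simps a_ac)

end

sublocale matrix_setting \<subseteq> rows: abelian_group "row_module R n"
  by (rule rows_abelian_group)

sublocale matrix_setting \<subseteq> mats: abelian_group "mat_ring R n"
  by (rule mats_abelian_group)

context matrix_setting
begin

lemma row_in_rows: "A \<in> carrier S \<Longrightarrow> i < n \<Longrightarrow> row A i \<in> carrier V"
  by (auto simp: mats_carrier_iff rows_carrier_iff)

lemma smult_in_rows: "r \<in> carrier R \<Longrightarrow> v \<in> carrier V \<Longrightarrow> r \<odot>\<^bsub>V\<^esub> v \<in> carrier V"
  by (auto simp: rows_carrier_iff row_module_simps)

lemma mult_in_mats: "A \<in> carrier S \<Longrightarrow> B \<in> carrier S \<Longrightarrow> A \<otimes>\<^bsub>S\<^esub> B \<in> carrier S"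
  by (auto simp: mats_carrier_iff mat_ring_simps intro!: finsum_closed)

lemma mats_eqI:
  assumes "A \<in> carrier S" "B \<in> carrier S" "\<And>i. i < n \<Longrightarrow> row A i = row B i"
  shows "A = B"
  using assms by (intro eq_rowI) (auto simp: mats_carrier_iff)

lemma rows_neg: "v \<in> carrier V \<Longrightarrow> \<ominus>\<^bsub>V\<^esub> v = (\<ominus> \<one>) \<odot>\<^bsub>V\<^esub> v"
  by (rule rows.minus_equality)
    (auto simp: rows_carrier_iff row_module_simps l_minus l_neg)

lemma mats_neg: "A \<in> carrier S \<Longrightarrow> \<ominus>\<^bsub>S\<^esub> A = mat n n (\<lambda>(i, j). \<ominus> A $$ (i, j))"
  by (rule mats.minus_equality)
    (auto simp: mats_carrier_iff mat_ring_simps l_neg)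

lemma smult_finsum:
  assumes "finite K" "f \<in> K \<rightarrow> carrier R" "v \<in> carrier V"
  shows "(\<Oplus>k\<in>K. f k) \<odot>\<^bsub>V\<^esub> v = (\<Oplus>\<^bsub>V\<^esub>k\<in>K. f k \<odot>\<^bsub>V\<^esub> v)"
  using assms
proof (induction K rule: finite_induct)
  case empty
  then show ?case by (auto simp: row_module_simps rows_carrier_iff)
next
  case (insert k K)
  have "(f k \<oplus> (\<Oplus>k\<in>K. f k)) \<odot>\<^bsub>V\<^esub> v = f k \<odot>\<^bsub>V\<^esub> v \<oplus>\<^bsub>V\<^esub> (\<Oplus>k\<in>K. f k) \<odot>\<^bsub>V\<^esub> v"
    using insert.prems finsum_closed[of f K]
    by (auto simp: row_module_simps rows_carrier_iff Pi_def l_distr)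
  moreover have "(\<lambda>k. f k \<odot>\<^bsub>V\<^esub> v) \<in> insert k K \<rightarrow> carrier V"
    using insert.prems smult_in_rows by auto
  ultimately show ?case using insert by (simp add: Pi_def)
qed

lemma finsum_rows_index:
  assumes "finite K" "f \<in> K \<rightarrow> carrier V" "j < n"
  shows "(\<Oplus>\<^bsub>V\<^esub>k\<in>K. f k) $ j = (\<Oplus>k\<in>K. f k $ j)"
  using assms
proof (induction K rule: finite_induct)
  case empty
  then show ?case by (simp add: row_module_simps)
next
  case (insert k K)
  have "(\<lambda>k. f k $ j) \<in> insert k K \<rightarrow> carrier R"
    using insert.prems by (simp add: rows_carrier_iff Pi_iff)
  then show ?case using insert by (simp add: Pi_def row_module_simps(2))
qed

lemma row_finsum_mats:
  assumes "finite K" "f \<in> K \<rightarrow> carrier S" "i < n"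
  shows "row (\<Oplus>\<^bsub>S\<^esub>k\<in>K. f k) i = (\<Oplus>\<^bsub>V\<^esub>k\<in>K. row (f k) i)"
  using assms
proof (induction K rule: finite_induct)
  case empty
  then show ?case by (simp add: row_module_simps mat_ring_simps)
next
  case (insert k K)
  have "row (f k \<oplus>\<^bsub>S\<^esub> (\<Oplus>\<^bsub>S\<^esub>k\<in>K. f k)) i = row (f k) i \<oplus>\<^bsub>V\<^esub> row (\<Oplus>\<^bsub>S\<^esub>k\<in>K. f k) i"
    using insert.prems mats.finsum_closed[of f K]
    by (auto simp: row_module_simps mat_ring_simps mats_carrier_iff)
  moreover have "(\<lambda>k. row (f k) i) \<in> insert k K \<rightarrow> carrier V"
    using insert.prems row_in_rows by auto
  ultimately show ?case using insert by (simp add: Pi_def)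
qed

lemma rows_finsum_single:
  assumes "j < n" "\<And>k. k < n \<Longrightarrow> f k = (if k = j then v else \<zero>\<^bsub>V\<^esub>)" "v \<in> carrier V"
  shows "(\<Oplus>\<^bsub>V\<^esub>k\<in>{..<n}. f k) = v"
proof -
  have "(\<Oplus>\<^bsub>V\<^esub>k\<in>{..<n}. f k) = (\<Oplus>\<^bsub>V\<^esub>k\<in>{..<n}. if j = k then v else \<zero>\<^bsub>V\<^esub>)"
    using assms by (intro rows.finsum_cong') auto
  also have "\<dots> = v"
    using assms rows.finsum_singleton[of j "{..<n}" "\<lambda>_. v"] by simp
  finally show ?thesis .
qed

section \<open>Products with matrices having one nonzero row\<close>

definition row_mat :: "nat \<Rightarrow> 'a vec \<Rightarrow> 'a mat" where
  "row_mat i v = mat n n (\<lambda>(a, b). if a = i then v $ b else \<zero>)"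

text \<open>
  The unit vectors are kept separate from \<open>row_mat\<close> because the same lemmas then serve for a whole
  row \<open>v\<close> put in place and for the multiple \<open>row_mat j (single k s)\<close> of a matrix unit.
\<close>

definition single :: "nat \<Rightarrow> 'a \<Rightarrow> 'a vec" where
  "single k s = vec n (\<lambda>l. if l = k then s else \<zero>)"

lemma row_mat_in_mats: "v \<in> carrier V \<Longrightarrow> row_mat i v \<in> carrier S"
  by (auto simp: row_mat_def mats_carrier_iff rows_carrier_iff)

lemma row_row_mat:
  "v \<in> carrier V \<Longrightarrow> a < n \<Longrightarrow> row (row_mat i v) a = (if a = i then v else \<zero>\<^bsub>V\<^esub>)"
  by (auto simp: row_mat_def rows_carrier_iff row_module_simps)

lemma single_in_rows: "s \<in> carrier R \<Longrightarrow> single k s \<in> carrier V"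
  by (auto simp: single_def rows_carrier_iff)

lemma smult_single:
  "r \<in> carrier R \<Longrightarrow> s \<in> carrier R \<Longrightarrow> r \<odot>\<^bsub>V\<^esub> single k s = single k (r \<otimes> s)"
  by (auto simp: single_def row_module_simps)

lemma zero_smult: "v \<in> carrier V \<Longrightarrow> \<zero> \<odot>\<^bsub>V\<^esub> v = \<zero>\<^bsub>V\<^esub>"
  by (auto simp: rows_carrier_iff row_module_simps)

lemma smult_zero: "r \<in> carrier R \<Longrightarrow> r \<odot>\<^bsub>V\<^esub> \<zero>\<^bsub>V\<^esub> = \<zero>\<^bsub>V\<^esub>"
  by (auto simp: row_module_simps)

lemma one_smult: "v \<in> carrier V \<Longrightarrow> \<one> \<odot>\<^bsub>V\<^esub> v = v"
  by (auto simp: rows_carrier_iff row_module_simps)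

text \<open>
  Products are computed row by row, since membership in \<open>\<Psi>(N)\<close> is a condition on rows and \<open>N\<close> is
  closed under the linear combination that appears here.
\<close>

lemma row_mult:
  assumes "A \<in> carrier S" "B \<in> carrier S" "i < n"
  shows "row (A \<otimes>\<^bsub>S\<^esub> B) i = (\<Oplus>\<^bsub>V\<^esub>k\<in>{..<n}. A $$ (i, k) \<odot>\<^bsub>V\<^esub> row B k)" (is "_ = ?sum")
proof (rule eq_vecI)
  have f: "(\<lambda>k. A $$ (i, k) \<odot>\<^bsub>V\<^esub> row B k) \<in> {..<n} \<rightarrow> carrier V"
    using assms by (auto intro!: smult_in_rows row_in_rows simp: mats_carrier_iff)
  then have dim: "dim_vec ?sum = n"
    using rows.finsum_closed rows_carrier_iff by blast
  then show "dim_vec (row (A \<otimes>\<^bsub>S\<^esub> B) i) = dim_vec ?sum"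
    by (simp add: mat_ring_simps)
  fix j assume "j < dim_vec ?sum"
  then have j: "j < n" using dim by simp
  then have "?sum $ j = (\<Oplus>k\<in>{..<n}. A $$ (i, k) \<otimes> B $$ (k, j))"
    using f assms
    by (subst finsum_rows_index)
      (auto simp: row_module_simps mats_carrier_iff intro!: finsum_cong')
  then show "row (A \<otimes>\<^bsub>S\<^esub> B) i $ j = ?sum $ j"
    using assms j by (simp add: mat_ring_simps)
qed

lemma row_mult_row_mat:
  assumes A: "A \<in> carrier S" and v: "v \<in> carrier V" and i: "i < n" and j: "j < n"
  shows "row (A \<otimes>\<^bsub>S\<^esub> row_mat j v) i = A $$ (i, j) \<odot>\<^bsub>V\<^esub> v"
proof -
  have c: "A $$ (i, k) \<in> carrier R" if "k < n" for k
    using A i that by (simp add: mats_carrier_iff)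
  show ?thesis
    unfolding row_mult[OF A row_mat_in_mats[OF v] i]
    using j c v
    by (intro rows_finsum_single) (auto simp: row_row_mat smult_zero intro: smult_in_rows)
qed

text \<open>This computes the products that have a matrix unit as left or middle factor.\<close>

lemma row_mult_of_single:
  assumes A: "A \<in> carrier S" and B: "B \<in> carrier S" and i: "i < n" and k: "k < n"
    and row: "row A i = single k t" and t: "t \<in> carrier R"
  shows "row (A \<otimes>\<^bsub>S\<^esub> B) i = t \<odot>\<^bsub>V\<^esub> row B k"
proof -
  have entry: "A $$ (i, l) = (if l = k then t else \<zero>)" if "l < n" for l
  proof -
    have "A $$ (i, l) = row A i $ l" using A i that by (auto simp: mats_carrier_iff)
    then show ?thesis unfolding row using that by (simp add: single_def)
  qed
  show ?thesis
    unfolding row_mult[OF A B i]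
    using k t B
    by (intro rows_finsum_single) (auto simp: entry zero_smult row_in_rows intro: smult_in_rows)
qed

lemma unit_mult:
  assumes B: "B \<in> carrier S" and j: "j < n" and k: "k < n" and s: "s \<in> carrier R"
  shows "row_mat j (single k s) \<otimes>\<^bsub>S\<^esub> B = row_mat j (s \<odot>\<^bsub>V\<^esub> row B k)"
proof (rule mats_eqI)
  let ?E = "row_mat j (single k s)"
  have E: "?E \<in> carrier S" using s by (intro row_mat_in_mats single_in_rows)
  show "?E \<otimes>\<^bsub>S\<^esub> B \<in> carrier S" using E B by (rule mult_in_mats)
  have v: "s \<odot>\<^bsub>V\<^esub> row B k \<in> carrier V" using s B k by (intro smult_in_rows row_in_rows)
  then show "row_mat j (s \<odot>\<^bsub>V\<^esub> row B k) \<in> carrier S" by (rule row_mat_in_mats)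
  fix i assume i: "i < n"
  \<comment> \<open>A zero row is treated as a multiple of the same unit vector, with coefficient zero.\<close>
  have "row ?E i = single k (if i = j then s else \<zero>)"
    using s i by (auto simp: row_row_mat single_in_rows) (simp add: single_def row_module_simps)
  then have "row (?E \<otimes>\<^bsub>S\<^esub> B) i = (if i = j then s else \<zero>) \<odot>\<^bsub>V\<^esub> row B k"
    using E B i k s by (intro row_mult_of_single) auto
  then show "row (?E \<otimes>\<^bsub>S\<^esub> B) i = row (row_mat j (s \<odot>\<^bsub>V\<^esub> row B k)) i"
    using v i B k by (simp add: row_row_mat zero_smult row_in_rows)
qed

lemma row_sandwich:
  assumes A: "A \<in> carrier S" and B: "B \<in> carrier S" and i: "i < n" and j: "j < n" and k: "k < n"
    and s: "s \<in> carrier R"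
  shows "row (A \<otimes>\<^bsub>S\<^esub> row_mat j (single k s) \<otimes>\<^bsub>S\<^esub> B) i = (A $$ (i, j) \<otimes> s) \<odot>\<^bsub>V\<^esub> row B k"
proof (rule row_mult_of_single)
  have a: "A $$ (i, j) \<in> carrier R" using A i j by (simp add: mats_carrier_iff)
  show "A \<otimes>\<^bsub>S\<^esub> row_mat j (single k s) \<in> carrier S"
    using A s by (intro mult_in_mats row_mat_in_mats single_in_rows)
  show "row (A \<otimes>\<^bsub>S\<^esub> row_mat j (single k s)) i = single k (A $$ (i, j) \<otimes> s)"
    using A a s i j by (simp add: row_mult_row_mat single_in_rows smult_single)
  show "A $$ (i, j) \<otimes> s \<in> carrier R" using a s by simp
qed (use B i k in auto)

lemma sum_of_rows:
  assumes A: "A \<in> carrier S"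
  shows "A = (\<Oplus>\<^bsub>S\<^esub>i\<in>{..<n}. row_mat i (row A i))"
proof (rule mats_eqI)
  have f: "(\<lambda>i. row_mat i (row A i)) \<in> {..<n} \<rightarrow> carrier S"
    using A by (auto intro!: row_mat_in_mats row_in_rows)
  then show "(\<Oplus>\<^bsub>S\<^esub>i\<in>{..<n}. row_mat i (row A i)) \<in> carrier S" by (rule mats.finsum_closed)
  fix a assume a: "a < n"
  then have "(\<Oplus>\<^bsub>V\<^esub>i\<in>{..<n}. row (row_mat i (row A i)) a) = row A a"
    using A by (intro rows_finsum_single) (auto simp: row_row_mat row_in_rows)
  then show "row A a = row (\<Oplus>\<^bsub>S\<^esub>i\<in>{..<n}. row_mat i (row A i)) a"
    using f a by (simp add: row_finsum_mats)
qed (rule A)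

section \<open>The correspondence\<close>

lemma submodule_subgroup: "submodule N R V \<Longrightarrow> subgroup N (add_monoid V)"
  by (rule submodule.axioms(1))

lemma submodule_zero: "submodule N R V \<Longrightarrow> \<zero>\<^bsub>V\<^esub> \<in> N"
  using subgroup.one_closed[OF submodule_subgroup] by simp

lemma submodule_subset: "submodule N R V \<Longrightarrow> N \<subseteq> carrier V"
  using subgroup.subset[OF submodule_subgroup] by simp

lemma left_ideal_subset: "left_ideal I S \<Longrightarrow> I \<subseteq> carrier S"
  unfolding left_ideal_def using additive_subgroup.a_subset by blast

lemma Phi_iff: "v \<in> Phi R n I \<longleftrightarrow> v \<in> carrier V \<and> row_mat 0 v \<in> I"
  by (simp add: Phi_def row_mat_def)

lemma Psi_iff: "A \<in> Psi R n N \<longleftrightarrow> A \<in> carrier S \<and> (\<forall>i<n. row A i \<in> N)"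
  by (simp add: Psi_def)

lemma row_mat_in_Psi_iff:
  assumes "submodule N R V" "v \<in> carrier V" "i < n"
  shows "row_mat i v \<in> Psi R n N \<longleftrightarrow> v \<in> N"
  using assms by (auto simp: Psi_iff row_mat_in_mats row_row_mat submodule_zero)

lemma Phi_submodule:
  assumes n: "n > 0" and I: "left_ideal I S"
  shows "submodule (Phi R n I) R V"
proof -
  have sub: "additive_subgroup I S" using I by (simp add: left_ideal_def)
  have smult: "r \<odot>\<^bsub>V\<^esub> v \<in> Phi R n I" if r: "r \<in> carrier R" and v: "v \<in> Phi R n I" for r v
  proof -
    have V: "v \<in> carrier V" and mem: "row_mat 0 v \<in> I" using v by (auto simp: Phi_iff)
    have "row_mat 0 (single 0 r) \<otimes>\<^bsub>S\<^esub> row_mat 0 v \<in> I"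
      using I r mem by (auto simp: left_ideal_def row_mat_in_mats single_in_rows)
    then have "row_mat 0 (r \<odot>\<^bsub>V\<^esub> v) \<in> I"
      using V r n by (simp add: unit_mult row_mat_in_mats row_row_mat)
    then show ?thesis using V r by (simp add: Phi_iff smult_in_rows)
  qed
  have add: "v \<oplus>\<^bsub>V\<^esub> w \<in> Phi R n I" if v: "v \<in> Phi R n I" and w: "w \<in> Phi R n I" for v w
  proof -
    have "row_mat 0 v \<oplus>\<^bsub>S\<^esub> row_mat 0 w = row_mat 0 (v \<oplus>\<^bsub>V\<^esub> w)"
      by (auto simp: row_mat_def mat_ring_simps row_module_simps)
    then show ?thesis
      using v w additive_subgroup.a_closed[OF sub] rows.a_closed by (metis Phi_iff)
  qed
  have "row_mat 0 \<zero>\<^bsub>V\<^esub> = \<zero>\<^bsub>S\<^esub>"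
    by (auto simp: row_mat_def mat_ring_simps row_module_simps)
  then have zero: "\<zero>\<^bsub>V\<^esub> \<in> Phi R n I"
    using additive_subgroup.zero_closed[OF sub] by (simp add: Phi_iff)
  have neg: "\<ominus>\<^bsub>V\<^esub> v \<in> Phi R n I" if "v \<in> Phi R n I" for v
    using that smult[of "\<ominus> \<one>" v] by (simp add: rows_neg Phi_iff)
  show ?thesis
  proof (intro submodule.intro subgroup.intro submodule_axioms.intro)
    show "Phi R n I \<subseteq> carrier (add_monoid V)" by (auto simp: Phi_iff)
  qed (use smult add zero neg in \<open>auto simp: a_inv_def\<close>)
qed

lemma Psi_left_ideal:
  assumes N: "submodule N R V"
  shows "left_ideal (Psi R n N) S"
proof -
  note sub = submodule_subgroup[OF N]
  have add: "A \<oplus>\<^bsub>S\<^esub> B \<in> Psi R n N" if A: "A \<in> Psi R n N" and B: "B \<in> Psi R n N" for A B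
  proof -
    have "row (A \<oplus>\<^bsub>S\<^esub> B) i = row A i \<oplus>\<^bsub>V\<^esub> row B i" if "i < n" for i
      using A B that by (auto simp: Psi_iff mats_carrier_iff mat_ring_simps row_module_simps)
    then show ?thesis
      using A B subgroup.m_closed[OF sub] by (auto simp: Psi_iff)
  qed
  have neg: "\<ominus>\<^bsub>S\<^esub> A \<in> Psi R n N" if A: "A \<in> Psi R n N" for A
  proof -
    have AS: "A \<in> carrier S" using A by (simp add: Psi_iff)
    have "row (\<ominus>\<^bsub>S\<^esub> A) i = (\<ominus> \<one>) \<odot>\<^bsub>V\<^esub> row A i" if "i < n" for i
      using AS that by (auto simp: mats_neg mats_carrier_iff row_module_simps l_minus)
    then show ?thesis
      using A AS submodule.smult_closed[OF N] by (auto simp: Psi_iff)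
  qed
  have zero: "\<zero>\<^bsub>S\<^esub> \<in> Psi R n N"
    using submodule_zero[OF N] by (auto simp: Psi_iff) (simp add: mat_ring_simps row_module_simps)
  have mult: "A \<otimes>\<^bsub>S\<^esub> B \<in> Psi R n N" if A: "A \<in> carrier S" and B: "B \<in> Psi R n N" for A B
  proof -
    have BS: "B \<in> carrier S" using B by (simp add: Psi_iff)
    have "row (A \<otimes>\<^bsub>S\<^esub> B) i \<in> N" if i: "i < n" for i
      unfolding row_mult[OF A BS i]
      using A B i
      by (intro rows.subgroup_finsum_closed[OF sub])
        (auto simp: Psi_iff mats_carrier_iff intro!: submodule.smult_closed[OF N])
    then show ?thesis using A BS by (simp add: Psi_iff mult_in_mats)
  qed
  show ?thesis
    unfolding left_ideal_def
  proof (intro conjI ballI additive_subgroup.intro subgroup.intro)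
    show "Psi R n N \<subseteq> carrier (add_monoid S)" by (auto simp: Psi_iff)
  qed (use add neg zero mult in \<open>auto simp: a_inv_def\<close>)
qed

lemma Phi_Psi:
  assumes "n > 0" "submodule N R V"
  shows "Phi R n (Psi R n N) = N"
  using assms submodule_subset[OF assms(2)] by (auto simp: Phi_iff row_mat_in_Psi_iff)

text \<open>
  For \<open>A\<close> with all rows in \<open>\<Phi>(I)\<close>, matrix units move each row from the top, where membership in
  \<open>\<Phi>(I)\<close> places it, to its position in \<open>A\<close> without leaving \<open>I\<close>; the sum of the results is \<open>A\<close>.
\<close>

lemma Psi_Phi:
  assumes n: "n > 0" and I: "left_ideal I S"
  shows "Psi R n (Phi R n I) = I"
proof (intro subset_antisym subsetI)
  have sub: "subgroup I (add_monoid S)"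
    using I additive_subgroup.a_subgroup unfolding left_ideal_def by blast
  \<comment> \<open>Left multiplication by a matrix unit moves a row of a member of \<open>I\<close> to any position.\<close>
  have move: "row_mat j (row A k) \<in> I" if A: "A \<in> I" and j: "j < n" and k: "k < n" for A j k
  proof -
    have AS: "A \<in> carrier S" using A left_ideal_subset[OF I] by blast
    have "row_mat j (single k \<one>) \<otimes>\<^bsub>S\<^esub> A \<in> I"
      using I A by (auto simp: left_ideal_def row_mat_in_mats single_in_rows)
    then show ?thesis using AS j k by (simp add: unit_mult one_smult row_in_rows)
  qed
  show "A \<in> Psi R n (Phi R n I)" if A: "A \<in> I" for A
    using A n left_ideal_subset[OF I] move by (auto simp: Psi_iff Phi_iff row_in_rows)
  show "A \<in> I" if A: "A \<in> Psi R n (Phi R n I)" for A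
  proof -
    have AS: "A \<in> carrier S" using A by (simp add: Psi_iff)
    have "row_mat i (row A i) \<in> I" if i: "i < n" for i
    proof -
      have "row_mat 0 (row A i) \<in> I" using A i by (auto simp: Psi_iff Phi_iff)
      from move[OF this i n] show ?thesis using AS i n by (simp add: row_row_mat row_in_rows)
    qed
    then have "(\<Oplus>\<^bsub>S\<^esub>i\<in>{..<n}. row_mat i (row A i)) \<in> I"
      by (intro mats.subgroup_finsum_closed[OF sub]) auto
    then show ?thesis using sum_of_rows[OF AS] by simp
  qed
qed

section \<open>Primeness and semiprimeness\<close>

text \<open>
  Taking \<open>s\<close> to be a multiple of a matrix unit isolates one entry of \<open>x\<close> and one row of \<open>y\<close>. For
  general \<open>s\<close>, row \<open>i\<close> of the product is the double sum of the vectors \<open>(x\<^sub>i\<^sub>j s\<^sub>j\<^sub>k) y\<^sub>k\<close>; the right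
  factor \<open>s\<^sub>j\<^sub>k\<close> is an arbitrary scalar, which is why \<open>R\<close> appears in the middle of the condition.
\<close>

lemma sandwich_in_Psi_iff:
  assumes N: "submodule N R V" and x: "x \<in> carrier S" and y: "y \<in> carrier S"
  shows "(\<forall>s \<in> carrier S. x \<otimes>\<^bsub>S\<^esub> s \<otimes>\<^bsub>S\<^esub> y \<in> Psi R n N) \<longleftrightarrow>
    (\<forall>i<n. \<forall>j<n. \<forall>k<n. \<forall>s \<in> carrier R. (x $$ (i, j) \<otimes> s) \<odot>\<^bsub>V\<^esub> row y k \<in> N)"
    (is "?L \<longleftrightarrow> ?R")
proof
  assume L: ?L
  show ?R
  proof (intro allI impI ballI)
    fix i j k s assume i: "i < n" and j: "j < n" and k: "k < n" and s: "s \<in> carrier R"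
    have "row (x \<otimes>\<^bsub>S\<^esub> row_mat j (single k s) \<otimes>\<^bsub>S\<^esub> y) i \<in> N"
      using L i s by (simp add: Psi_iff row_mat_in_mats single_in_rows)
    then show "(x $$ (i, j) \<otimes> s) \<odot>\<^bsub>V\<^esub> row y k \<in> N"
      using row_sandwich[OF x y i j k s] by simp
  qed
next
  assume R: ?R
  note closed = rows.subgroup_finsum_closed[OF submodule_subgroup[OF N]]
  show ?L
  proof
    fix s assume s: "s \<in> carrier S"
    have xs: "x \<otimes>\<^bsub>S\<^esub> s \<in> carrier S" using x s by (rule mult_in_mats)
    have "row (x \<otimes>\<^bsub>S\<^esub> s \<otimes>\<^bsub>S\<^esub> y) i \<in> N" if i: "i < n" for i
      unfolding row_mult[OF xs y i]
    proof (rule closed)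
      fix k assume "k \<in> {..<n}"
      then have k: "k < n" by simp
      have "(x \<otimes>\<^bsub>S\<^esub> s) $$ (i, k) \<odot>\<^bsub>V\<^esub> row y k
          = (\<Oplus>j\<in>{..<n}. x $$ (i, j) \<otimes> s $$ (j, k)) \<odot>\<^bsub>V\<^esub> row y k"
        using i k by (simp add: mat_ring_simps)
      also have "\<dots> = (\<Oplus>\<^bsub>V\<^esub>j\<in>{..<n}. (x $$ (i, j) \<otimes> s $$ (j, k)) \<odot>\<^bsub>V\<^esub> row y k)"
        using x y s i k by (intro smult_finsum) (auto simp: mats_carrier_iff row_in_rows)
      also have "\<dots> \<in> N"
        using R s i k by (intro closed) (auto simp: mats_carrier_iff)
      finally show "(x \<otimes>\<^bsub>S\<^esub> s) $$ (i, k) \<odot>\<^bsub>V\<^esub> row y k \<in> N" .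
    qed simp
    then show "x \<otimes>\<^bsub>S\<^esub> s \<otimes>\<^bsub>S\<^esub> y \<in> Psi R n N"
      using xs y by (simp add: Psi_iff mult_in_mats)
  qed
qed

text \<open>
  Here an arbitrary vector, rather than a unit vector, is placed in row \<open>j\<close> of \<open>s\<close>: this produces
  the condition on all of \<open>R\<^sup>n\<close> that occurs in the definition of a prime submodule.
\<close>

lemma right_multiples_in_Psi_iff:
  assumes N: "submodule N R V" and x: "x \<in> carrier S"
  shows "(\<forall>s \<in> carrier S. x \<otimes>\<^bsub>S\<^esub> s \<in> Psi R n N) \<longleftrightarrow>
    (\<forall>i<n. \<forall>j<n. \<forall>v \<in> carrier V. x $$ (i, j) \<odot>\<^bsub>V\<^esub> v \<in> N)"
    (is "?L \<longleftrightarrow> ?R")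
proof
  assume L: ?L
  show ?R
  proof (intro allI impI ballI)
    fix i j v assume i: "i < n" and j: "j < n" and v: "v \<in> carrier V"
    have "row (x \<otimes>\<^bsub>S\<^esub> row_mat j v) i \<in> N"
      using L i v by (simp add: Psi_iff row_mat_in_mats)
    then show "x $$ (i, j) \<odot>\<^bsub>V\<^esub> v \<in> N" using row_mult_row_mat[OF x v i j] by simp
  qed
next
  assume R: ?R
  show ?L
  proof
    fix s assume s: "s \<in> carrier S"
    have "row (x \<otimes>\<^bsub>S\<^esub> s) i \<in> N" if i: "i < n" for i
      unfolding row_mult[OF x s i]
      using R i s
      by (intro rows.subgroup_finsum_closed[OF submodule_subgroup[OF N]]) (auto simp: row_in_rows)
    then show "x \<otimes>\<^bsub>S\<^esub> s \<in> Psi R n N" using x s by (simp add: Psi_iff mult_in_mats)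
  qed
qed

lemma row_mat_index:
  "i < n \<Longrightarrow> j < n \<Longrightarrow> row_mat a v $$ (i, j) = (if i = a then v $ j else \<zero>)"
  by (simp add: row_mat_def)

lemma prime_Psi_iff:
  assumes n: "n > 0" and N: "submodule N R V"
  shows "prime_left_ideal (Psi R n N) S \<longleftrightarrow> prime_submodule N R V"
proof
  assume P: "prime_left_ideal (Psi R n N) S"
  have "m \<in> N \<or> (\<forall>x \<in> carrier V. r \<odot>\<^bsub>V\<^esub> x \<in> N)"
    if r: "r \<in> carrier R" and m: "m \<in> carrier V"
      and rm: "\<forall>s \<in> carrier R. (r \<otimes> s) \<odot>\<^bsub>V\<^esub> m \<in> N" for r m
  proof -
    \<comment> \<open>The scalar \<open>r\<close> becomes the matrix with \<open>r\<close> in the top left corner, and \<open>m\<close> becomes a first row.\<close>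
    let ?x = "row_mat 0 (single 0 r)" and ?y = "row_mat 0 m"
    have x: "?x \<in> carrier S" and y: "?y \<in> carrier S"
      using r m by (auto intro: row_mat_in_mats single_in_rows)
    have entry: "?x $$ (i, j) = (if i = 0 \<and> j = 0 then r else \<zero>)" if "i < n" "j < n" for i j
      using that by (simp add: row_mat_index single_def)
    have "(?x $$ (i, j) \<otimes> s) \<odot>\<^bsub>V\<^esub> row ?y k \<in> N"
      if "i < n" "j < n" "k < n" "s \<in> carrier R" for i j k s
      using that r m rm N
      by (auto simp: entry row_row_mat smult_zero submodule_zero zero_smult)
    then have "\<forall>s \<in> carrier S. ?x \<otimes>\<^bsub>S\<^esub> s \<otimes>\<^bsub>S\<^esub> ?y \<in> Psi R n N"
      unfolding sandwich_in_Psi_iff[OF N x y] by blast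
    then have "(\<forall>s \<in> carrier S. ?x \<otimes>\<^bsub>S\<^esub> s \<in> Psi R n N) \<or> ?y \<in> Psi R n N"
      using P x y unfolding prime_left_ideal_def by blast
    then show ?thesis
    proof
      assume "?y \<in> Psi R n N"
      then show ?thesis using row_mat_in_Psi_iff[OF N m n] by blast
    next
      assume "\<forall>s \<in> carrier S. ?x \<otimes>\<^bsub>S\<^esub> s \<in> Psi R n N"
      then have "\<forall>v \<in> carrier V. ?x $$ (0, 0) \<odot>\<^bsub>V\<^esub> v \<in> N"
        unfolding right_multiples_in_Psi_iff[OF N x] using n by blast
      then show ?thesis using n by (simp add: entry)
    qed
  qed
  then show "prime_submodule N R V" unfolding prime_submodule_def using N by blast
next
  assume P: "prime_submodule N R V"
  have "(\<forall>s \<in> carrier S. x \<otimes>\<^bsub>S\<^esub> s \<in> Psi R n N) \<or> y \<in> Psi R n N"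
    if x: "x \<in> carrier S" and y: "y \<in> carrier S"
      and xy: "\<forall>s \<in> carrier S. x \<otimes>\<^bsub>S\<^esub> s \<otimes>\<^bsub>S\<^esub> y \<in> Psi R n N" for x y
  proof (rule disjCI)
    assume "y \<notin> Psi R n N"
    \<comment> \<open>A single row outside \<open>N\<close> tests all entries of \<open>x\<close>.\<close>
    then obtain k where k: "k < n" and yk: "row y k \<notin> N" using y by (auto simp: Psi_iff)
    have "\<forall>v \<in> carrier V. x $$ (i, j) \<odot>\<^bsub>V\<^esub> v \<in> N" if i: "i < n" and j: "j < n" for i j
    proof -
      have "x $$ (i, j) \<in> carrier R" using x i j by (simp add: mats_carrier_iff)
      moreover have "\<forall>s \<in> carrier R. (x $$ (i, j) \<otimes> s) \<odot>\<^bsub>V\<^esub> row y k \<in> N"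
        using xy i j k unfolding sandwich_in_Psi_iff[OF N x y] by blast
      ultimately show ?thesis
        using P yk row_in_rows[OF y k] unfolding prime_submodule_def by blast
    qed
    then show "\<forall>s \<in> carrier S. x \<otimes>\<^bsub>S\<^esub> s \<in> Psi R n N"
      unfolding right_multiples_in_Psi_iff[OF N x] by blast
  qed
  then show "prime_left_ideal (Psi R n N) S"
    unfolding prime_left_ideal_def using Psi_left_ideal[OF N] by blast
qed

lemma semiprime_Psi_iff:
  assumes n: "n > 0" and N: "submodule N R V"
  shows "semiprime_left_ideal (Psi R n N) S \<longleftrightarrow> semiprime_submodule N R n"
proof
  assume P: "semiprime_left_ideal (Psi R n N) S"
  have "m \<in> N"
    if m: "m \<in> carrier V"
      and mm: "\<forall>i<n. \<forall>s \<in> carrier R. (m $ i \<otimes> s) \<odot>\<^bsub>V\<^esub> m \<in> N" for m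
  proof -
    \<comment> \<open>With \<open>m\<close> as first row and zeros below, entries and rows of the matrix both come from \<open>m\<close>.\<close>
    let ?x = "row_mat 0 m"
    have x: "?x \<in> carrier S" using m by (rule row_mat_in_mats)
    have mc: "m $ j \<in> carrier R" if "j < n" for j using m that by (simp add: rows_carrier_iff)
    have "(?x $$ (i, j) \<otimes> s) \<odot>\<^bsub>V\<^esub> row ?x k \<in> N"
      if "i < n" "j < n" "k < n" "s \<in> carrier R" for i j k s
      using that m mc mm N
      by (auto simp: row_mat_index row_row_mat smult_zero submodule_zero zero_smult)
    then have "\<forall>s \<in> carrier S. ?x \<otimes>\<^bsub>S\<^esub> s \<otimes>\<^bsub>S\<^esub> ?x \<in> Psi R n N"
      unfolding sandwich_in_Psi_iff[OF N x x] by blast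
    then have "?x \<in> Psi R n N" using P x unfolding semiprime_left_ideal_def by blast
    then show ?thesis using row_mat_in_Psi_iff[OF N m n] by blast
  qed
  then show "semiprime_submodule N R n" unfolding semiprime_submodule_def using N by blast
next
  assume P: "semiprime_submodule N R n"
  have "x \<in> Psi R n N"
    if x: "x \<in> carrier S" and xx: "\<forall>s \<in> carrier S. x \<otimes>\<^bsub>S\<^esub> s \<otimes>\<^bsub>S\<^esub> x \<in> Psi R n N" for x
  proof -
    have "row x k \<in> N" if k: "k < n" for k
    proof -
      \<comment> \<open>Semiprimeness of \<open>N\<close> asks for row \<open>k\<close> to be tested against its own entries.\<close>
      have "\<forall>i<n. \<forall>s \<in> carrier R. (x $$ (k, i) \<otimes> s) \<odot>\<^bsub>V\<^esub> row x k \<in> N"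
        using xx k unfolding sandwich_in_Psi_iff[OF N x x] by blast
      moreover have "row x k $ i = x $$ (k, i)" if "i < n" for i
        using x k that by (auto simp: mats_carrier_iff)
      ultimately show ?thesis
        using P row_in_rows[OF x k] unfolding semiprime_submodule_def by simp
    qed
    then show ?thesis using x by (simp add: Psi_iff)
  qed
  then show "semiprime_left_ideal (Psi R n N) S"
    unfolding semiprime_left_ideal_def using Psi_left_ideal[OF N] by blast
qed

end

theorem proposition3:
  fixes R :: "('a, 'b) ring_scheme" and n :: nat
  assumes "ring R" and "n > 0"
  shows "bij_betw (Phi R n) {I. left_ideal I (mat_ring R n)} {N. submodule N R (row_module R n)}
    \<and> (\<forall>I. left_ideal I (mat_ring R n) \<longrightarrow> Psi R n (Phi R n I) = I)
    \<and> (\<forall>N. submodule N R (row_module R n) \<longrightarrow> Phi R n (Psi R n N) = N)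
    \<and> (\<forall>I. left_ideal I (mat_ring R n) \<longrightarrow>
          (prime_left_ideal I (mat_ring R n) \<longleftrightarrow> prime_submodule (Phi R n I) R (row_module R n)))
    \<and> (\<forall>N. submodule N R (row_module R n) \<longrightarrow>
          (prime_submodule N R (row_module R n) \<longleftrightarrow> prime_left_ideal (Psi R n N) (mat_ring R n)))
    \<and> (\<forall>I. left_ideal I (mat_ring R n) \<longrightarrow>
          (semiprime_left_ideal I (mat_ring R n) \<longleftrightarrow> semiprime_submodule (Phi R n I) R n))
    \<and> (\<forall>N. submodule N R (row_module R n) \<longrightarrow>
          (semiprime_submodule N R n \<longleftrightarrow> semiprime_left_ideal (Psi R n N) (mat_ring R n)))"
proof -
  interpret matrix_setting R n using assms(1) by (simp add: matrix_setting_def)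
  note n = assms(2)
  have bij: "bij_betw (Phi R n) {I. left_ideal I S} {N. submodule N R V}"
    using n
    by (intro bij_betw_byWitness[where f' = "Psi R n"])
      (auto simp: Psi_Phi Phi_Psi Phi_submodule Psi_left_ideal)
  have "prime_left_ideal I S \<longleftrightarrow> prime_submodule (Phi R n I) R V"
    "semiprime_left_ideal I S \<longleftrightarrow> semiprime_submodule (Phi R n I) R n"
    if I: "left_ideal I S" for I
    using prime_Psi_iff[OF n Phi_submodule[OF n I]] semiprime_Psi_iff[OF n Phi_submodule[OF n I]]
    unfolding Psi_Phi[OF n I] by auto
  then show ?thesis
    using bij n by (simp add: Psi_Phi Phi_Psi prime_Psi_iff semiprime_Psi_iff)
qed

end
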